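(* Let $\mathcal{H}^n$ be an $n$-dimensional real or complex Hilbert space ($n\ge 1$), and let $\mathcal{W}=\{(W_i,v_i)\}_{i=1}^{N}$ be a fusion frame for $\mathcal{H}^n$. Then the following hold. [D1] The normalized version $\{(W_i,1)\}_{i=1}^N$ of $\mathcal{W}$ is an $A$-tight fusion frame if and only if $\mathcal{R}_{\mathcal{W}}^-=\mathcal{R}_{\mathcal{W}}^+=A$. [D2] $\mathcal{W}$ is an orthonormal fusion basis for $\mathcal{H}^n$ if and only if $\mathcal{R}_{\mathcal{W}}^-=\mathcal{R}_{\mathcal{W}}^+=1$ and $v_i=1$ for all $i=1,\dots,N$. [D3] (Additivity) For each orthonormal fusion basis $\mathcal{E}=\{E_i\}_{i=1}^N$ of $\mathcal{H}^n$, $$\mathcal{R}_{\mathcal{W}\cup\mathcal{E}}^{-}=\mathcal{R}_{\mathcal{W}}^{-}+1\quad\text{and}\quad \mathcal{R}_{\mathcal{W}\cup\mathcal{E}}^{+}=\mathcal{R}_{\mathcal{W}}^{+}+1.$$ Moreover, for each (finite) fusion frame $\mathcal{V}$ for $\mathcal{H}^n$, $$\mathcal{R}_{\mathcal{W}\cup\mathcal{V}}^{-}\ge \mathcal{R}_{\mathcal{W}}^{-}+\mathcal{R}_{\mathcal{V}}^{-}\quad\text{and}\quad \mathcal{R}_{\mathcal{W}\cup\mathcal{V}}^{+}\le \mathcal{R}_{\mathcal{W}}^{+}+\mathcal{R}_{\mathcal{V}}^{+}.$$ In particular, if $\mathcal{W}$ and $\mathcal{V}$ both have uniform redundancy, then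 $$\mathcal{R}_{\mathcal{W}\cup\mathcal{V}}^{-}=\mathcal{R}_{\mathcal{W}}^{+}+\mathcal{R}_{\mathcal{V}}^{+}=\mathcal{R}_{\mathcal{W}\cup\mathcal{V}}^{+}.$$ [D4] (Invariance) For every unitary operator $U$ on $\mathcal{H}^n$, with $U(\mathcal{W})=\{(UW_i,v_i)\}_{i=1}^N$, one has $\mathcal{R}_{U(\mathcal{W})}^{-}=\mathcal{R}_{\mathcal{W}}^{-}$ and $\mathcal{R}_{U(\mathcal{W})}^{+}=\mathcal{R}_{\mathcal{W}}^{+}$; and for every permutation $\pi$ of $\{1,\dots,N\}$, the permuted family $\mathcal{W}_\pi=\{(W_{\pi(i)},v_{\pi(i)})\}_{i=1}^N$ satisfies $\mathcal{R}_{\mathcal{W}_\pi}^{-}=\mathcal{R}_{\mathcal{W}}^{-}$ and $\mathcal{R}_{\mathcal{W}_\pi}^{+}=\mathcal{R}_{\mathcal{W}}^{+}$.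
   Context: A fusion frame for a Hilbert space $\mathcal{H}$ is a countable family $\{(W_i,v_i)\}_{i\in I}$ of closed subspaces $W_i\subseteq\mathcal{H}$ with weights $v_i>0$ for which there are constants $0<A\le B<\infty$ with $A\|x\|^2\le\sum_{i\in I}v_i^2\|P_{W_i}(x)\|^2\le B\|x\|^2$ for all $x\in\mathcal{H}$, where $P_{W_i}$ is the orthogonal projection onto $W_i$. It is $A$-tight if one can take both bounds equal to $A$. The normalized version of $\{(W_i,v_i)\}$ is the family $\{(W_i,1)\}$ with all weights equal to 1. An orthonormal fusion basis for $\mathcal{H}$ is a family of closed subspaces $\{W_i\}$, all taken with weight $1$, such that $\mathcal{H}=\bigoplus_i W_i$ is an orthogonal direct sum (the $W_i$ are pairwise orthogonal and span $\mathcal{H}$). For a finite fusion frame $\mathcal{W}=\{(W_i,v_i)\}_{i=1}^N$ for $\mathcal{H}^n$ and $\mathbb{S}=\{x\in\mathcal{H}^n:\|x\|=1\}$, the redundancy function is $\mathcal{R}_{\mathcal{W}}:\mathbb{S}\to\mathbb{R}^+$, $\mathcal{R}_{\mathcal{W}}(x)=\sum_{i=1}^N\|P_{W_i}(x)\|^2$ (weights do not enter). The upper and lower redundancies are $\mathcal{R}_{\mathcal{W}}^+=\sup_{x\in\mathbb{S}}\mathcal{R}_{\mathcal{W}}(x)$ and $\mathcal{R}_{\mathcal{W}}^-=\inf_{x\in\mathbb{S}}\mathcal{R}_{\mathcal{W}}(x)$. $\mathcal{W}$ has uniform redundancy if $\mathcal{R}_{\mathcal{W}}^-=\mathcal{R}_{\mathcal{W}}^+$.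 The union $\mathcal{W}\cup\mathcal{V}$ of two fusion frames is the concatenated family, i.e. the family indexed by the disjoint union of the two index sets, so repeated subspaces are counted with multiplicity. *)

theory Defs
  imports "HOL-Analysis.Analysis" "HOL-Combinatorics.Permutations"
begin

text \<open>
  Scalars. By Gelfand--Mazur, a \<open>real_normed_field\<close> is isometrically isomorphic to the real or
  the complex numbers, and \<open>conjugate_mult_self\<close> determines the conjugation. So \<open>real\<close> and
  \<open>complex\<close> are, up to isomorphism, exactly the instances of the following class.
\<close>

class real_or_complex = real_normed_field +
  fixes conjugate :: "'a \<Rightarrow> 'a"
  assumes conjugate_add: "conjugate (x + y) = conjugate x + conjugate y"
    and conjugate_mult: "conjugate (x * y) = conjugate x * conjugate y"
    and conjugate_mult_self: "x * conjugate x = scaleR ((norm x)\<^sup>2) 1"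

instantiation real :: real_or_complex
begin
definition conjugate_real :: "real \<Rightarrow> real" where "conjugate_real x = x"
instance by standard (auto simp: conjugate_real_def power2_eq_square)
end

instantiation complex :: real_or_complex
begin
definition conjugate_complex :: "complex \<Rightarrow> complex" where "conjugate_complex z = cnj z"
instance
  by standard (auto simp: conjugate_complex_def complex_norm_square scaleR_conv_of_real
      simp flip: of_real_power)
end

text \<open>
  The norm and the topology are those of the type \<open>'a\<close>; \<open>inner_self\<close> says that the inner product
  induces this norm (so it is positive definite), and completeness is part of the class \<open>banach\<close>.
\<close>

locale hilbert_space = vector_space scaleK
  for scaleK :: "'k::real_or_complex \<Rightarrow> 'a::banach \<Rightarrow> 'a" +
  fixes ip :: "'a \<Rightarrow> 'a \<Rightarrow> 'k"
  assumes scale_of_real: "scaleK (of_real r) x = r *\<^sub>R x"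
    and inner_add_left: "ip (x + y) z = ip x z + ip y z"
    and inner_scale_left: "ip (scaleK c x) y = c * ip x y"
    and inner_conjugate: "ip x y = conjugate (ip y x)"
    and inner_self: "ip x x = of_real ((norm x)\<^sup>2)"

definition closed_subspace :: "('k::real_or_complex \<Rightarrow> 'a::banach \<Rightarrow> 'a) \<Rightarrow> 'a set \<Rightarrow> bool" where
  "closed_subspace scaleK W \<longleftrightarrow> module.subspace scaleK W \<and> closed W"

definition orth_proj :: "('a::banach \<Rightarrow> 'a \<Rightarrow> 'k::real_or_complex) \<Rightarrow> 'a set \<Rightarrow> 'a \<Rightarrow> 'a" where
  "orth_proj ip W x = (THE p. p \<in> W \<and> (\<forall>w\<in>W. ip (x - p) w = 0))"

definition unitary_operator ::
    "('k::real_or_complex \<Rightarrow> 'a::banach \<Rightarrow> 'a) \<Rightarrow> ('a \<Rightarrow> 'a \<Rightarrow> 'k) \<Rightarrow> ('a \<Rightarrow> 'a) \<Rightarrow> bool" where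
  "unitary_operator scaleK ip U \<longleftrightarrow>
     Vector_Spaces.linear scaleK scaleK U \<and> surj U \<and> (\<forall>x y. ip (U x) (U y) = ip x y)"

text \<open>
  A family \<open>{(W_i, v_i)}\<close>, \<open>i \<in> I\<close>, is given by its index set and a function; values of the
  function outside the index set are irrelevant.
\<close>

type_synonym ('i, 'a) weighted_family = "'i \<Rightarrow> 'a set \<times> real"

definition fusion_frame_bounds ::
    "('k::real_or_complex \<Rightarrow> 'a::banach \<Rightarrow> 'a) \<Rightarrow> ('a \<Rightarrow> 'a \<Rightarrow> 'k) \<Rightarrow>
     'i set \<Rightarrow> ('i, 'a) weighted_family \<Rightarrow> real \<Rightarrow> real \<Rightarrow> bool" where
  "fusion_frame_bounds scaleK ip I F A B \<longleftrightarrow>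
     countable I \<and>
     (\<forall>i\<in>I. closed_subspace scaleK (fst (F i)) \<and> snd (F i) > 0) \<and>
     0 < A \<and> A \<le> B \<and>
     (\<forall>x. (\<lambda>i. (snd (F i))\<^sup>2 * (norm (orth_proj ip (fst (F i)) x))\<^sup>2) summable_on I \<and>
          A * (norm x)\<^sup>2 \<le> (\<Sum>\<^sub>\<infinity>i\<in>I. (snd (F i))\<^sup>2 * (norm (orth_proj ip (fst (F i)) x))\<^sup>2) \<and>
          (\<Sum>\<^sub>\<infinity>i\<in>I. (snd (F i))\<^sup>2 * (norm (orth_proj ip (fst (F i)) x))\<^sup>2) \<le> B * (norm x)\<^sup>2)"

definition fusion_frame ::
    "('k::real_or_complex \<Rightarrow> 'a::banach \<Rightarrow> 'a) \<Rightarrow> ('a \<Rightarrow> 'a \<Rightarrow> 'k) \<Rightarrow>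
     'i set \<Rightarrow> ('i, 'a) weighted_family \<Rightarrow> bool" where
  "fusion_frame scaleK ip I F \<longleftrightarrow> (\<exists>A B. fusion_frame_bounds scaleK ip I F A B)"

definition tight_fusion_frame ::
    "('k::real_or_complex \<Rightarrow> 'a::banach \<Rightarrow> 'a) \<Rightarrow> ('a \<Rightarrow> 'a \<Rightarrow> 'k) \<Rightarrow>
     real \<Rightarrow> 'i set \<Rightarrow> ('i, 'a) weighted_family \<Rightarrow> bool" where
  "tight_fusion_frame scaleK ip A I F \<longleftrightarrow> fusion_frame_bounds scaleK ip I F A A"

text \<open>
  For infinite families the orthogonal direct sum is the Hilbert space direct sum, hence the
  closure of the span; in finite dimension the closure is redundant.
\<close>

definition orthonormal_fusion_basis ::
    "('k::real_or_complex \<Rightarrow> 'a::banach \<Rightarrow> 'a) \<Rightarrow> ('a \<Rightarrow> 'a \<Rightarrow> 'k) \<Rightarrow>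
     'i set \<Rightarrow> ('i, 'a) weighted_family \<Rightarrow> bool" where
  "orthonormal_fusion_basis scaleK ip I F \<longleftrightarrow>
     (\<forall>i\<in>I. closed_subspace scaleK (fst (F i)) \<and> snd (F i) = 1) \<and>
     (\<forall>i\<in>I. \<forall>j\<in>I. i \<noteq> j \<longrightarrow> (\<forall>x\<in>fst (F i). \<forall>y\<in>fst (F j). ip x y = 0)) \<and>
     closure (module.span scaleK (\<Union>i\<in>I. fst (F i))) = UNIV"

definition normalized :: "('i, 'a) weighted_family \<Rightarrow> ('i, 'a) weighted_family" where
  "normalized F = (\<lambda>i. (fst (F i), 1))"

text \<open>If \<open>F\<close> is indexed by \<open>I\<close> and \<open>G\<close> by \<open>J\<close>, then their union is indexed by \<open>I <+> J\<close>.\<close>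

definition family_union ::
    "('i, 'a) weighted_family \<Rightarrow> ('j, 'a) weighted_family \<Rightarrow> ('i + 'j, 'a) weighted_family" where
  "family_union F G = case_sum F G"

definition family_image :: "('a \<Rightarrow> 'a) \<Rightarrow> ('i, 'a) weighted_family \<Rightarrow> ('i, 'a) weighted_family" where
  "family_image U F = (\<lambda>i. (U ` fst (F i), snd (F i)))"

text \<open>The index set is meant to be finite here.\<close>

definition redundancy ::
    "('a::banach \<Rightarrow> 'a \<Rightarrow> 'k::real_or_complex) \<Rightarrow> 'i set \<Rightarrow> ('i, 'a) weighted_family \<Rightarrow> 'a \<Rightarrow> real" where
  "redundancy ip I F x = (\<Sum>i\<in>I. (norm (orth_proj ip (fst (F i)) x))\<^sup>2)"

definition upper_redundancy ::
    "('a::banach \<Rightarrow> 'a \<Rightarrow> 'k::real_or_complex) \<Rightarrow> 'i set \<Rightarrow> ('i, 'a) weighted_family \<Rightarrow> real" where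
  "upper_redundancy ip I F = (SUP x\<in>sphere 0 1. redundancy ip I F x)"

definition lower_redundancy ::
    "('a::banach \<Rightarrow> 'a \<Rightarrow> 'k::real_or_complex) \<Rightarrow> 'i set \<Rightarrow> ('i, 'a) weighted_family \<Rightarrow> real" where
  "lower_redundancy ip I F = (INF x\<in>sphere 0 1. redundancy ip I F x)"

definition uniform_redundancy ::
    "('a::banach \<Rightarrow> 'a \<Rightarrow> 'k::real_or_complex) \<Rightarrow> 'i set \<Rightarrow> ('i, 'a) weighted_family \<Rightarrow> bool" where
  "uniform_redundancy ip I F \<longleftrightarrow> lower_redundancy ip I F = upper_redundancy ip I F"

end

theory Submission
  imports Defs
begin

text \<open>
  Everything reduces to the redundancy function on the unit sphere. For an orthonormal fusion basis
  it is constantly 1 by Pythagoras. Conversely, suppose that it is constantly 1. A vector of \<open>W\<^sub>i\<close>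
  already exhausts the value through its own projection, so it is orthogonal to every other \<open>W\<^sub>j\<close>.
  A vector orthogonal to all \<open>W\<^sub>i\<close> has redundancy 0, so it vanishes, and the span is dense.
\<close>

section \<open>Inner product, norm, and closures of subspaces\<close>

lemma conjugate_0 [simp]: "conjugate (0 :: 'k::real_or_complex) = 0"
  using conjugate_add[of "0::'k" 0] by simp

context hilbert_space
begin

lemma inner_add_right: "ip x (y + z) = ip x y + ip x z"
  by (metis inner_add_left inner_conjugate conjugate_add)

lemma inner_diff_left: "ip (x - y) z = ip x z - ip y z"
  using inner_add_left[of "x - y" y z] by simp

lemma inner_diff_right: "ip x (y - z) = ip x y - ip x z"
  using inner_add_right[of x "y - z" z] by simp

lemma inner_zero_left [simp]: "ip 0 x = 0"
  using inner_diff_left[of 0 0 x] by simp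

lemma inner_zero_right [simp]: "ip x 0 = 0"
  using inner_diff_right[of x 0 0] by simp

lemma inner_sum_left: "ip (sum f A) y = (\<Sum>i\<in>A. ip (f i) y)"
  by (induction A rule: infinite_finite_induct) (auto simp: inner_add_left)

lemma inner_sum_right: "ip y (sum f A) = (\<Sum>i\<in>A. ip y (f i))"
  by (induction A rule: infinite_finite_induct) (auto simp: inner_add_right)

lemma orthogonal_sym: "ip x y = 0 \<Longrightarrow> ip y x = 0"
  using inner_conjugate[of y x] by simp

lemma inner_self_eq_0_iff: "ip x x = 0 \<longleftrightarrow> x = 0"
  by (simp add: inner_self)

lemma pythagoras:
  assumes "ip x y = 0"
  shows "(norm (x + y))\<^sup>2 = (norm x)\<^sup>2 + (norm y)\<^sup>2"
proof -
  \<comment> \<open>The identity is checked in the scalar field, where \<open>inner_self\<close>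
    turns squared norms into inner products; injectivity of \<open>of_real\<close> carries it back
    to the reals.\<close>
  have "of_real ((norm (x + y))\<^sup>2) = (of_real ((norm x)\<^sup>2 + (norm y)\<^sup>2) :: 'k)"
    using assms orthogonal_sym[OF assms]
    by (simp flip: inner_self of_real_power add: inner_add_left inner_add_right)
  then show ?thesis
    by (simp only: of_real_eq_iff)
qed

lemma parallelogram:
  fixes x y :: 'a
  shows "(norm (x + y))\<^sup>2 + (norm (x - y))\<^sup>2 = 2 * (norm x)\<^sup>2 + 2 * (norm y)\<^sup>2"
proof -
  have "ip (x + y) (x + y) + ip (x - y) (x - y) = 2 * ip x x + 2 * ip y y"
    by (simp add: inner_add_left inner_add_right inner_diff_left inner_diff_right)
  then have "of_real ((norm (x + y))\<^sup>2 + (norm (x - y))\<^sup>2) =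
      (of_real (2 * (norm x)\<^sup>2 + 2 * (norm y)\<^sup>2) :: 'k)"
    by (simp add: inner_self)
  then show ?thesis
    by (simp only: of_real_eq_iff)
qed

text \<open>The class \<open>banach\<close> gives homogeneity of the norm for real scalars only. For
  scalars in \<open>'k\<close> it follows from \<open>conjugate_mult_self\<close>, since the factor
  \<open>c * conjugate c\<close> comes out of the inner product.\<close>

lemma norm_scale:
  fixes x :: 'a and c :: 'k
  shows "norm (scaleK c x) = norm c * norm x"
proof -
  have "ip (scaleK c x) (scaleK c x) = c * conjugate (c * ip x x)"
    by (metis inner_scale_left inner_conjugate)
  also have "\<dots> = (c * conjugate c) * ip x x"
    using inner_conjugate[of x x] by (simp add: conjugate_mult)
  finally have "of_real ((norm (scaleK c x))\<^sup>2) = (of_real ((norm c)\<^sup>2 * (norm x)\<^sup>2) :: 'k)"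
    by (simp add: conjugate_mult_self inner_self scaleR_conv_of_real)
  then have "(norm (scaleK c x))\<^sup>2 = (norm c * norm x)\<^sup>2"
    by (simp only: of_real_eq_iff power_mult_distrib)
  then show ?thesis
    by simp
qed

text \<open>Makes the closure of a span a closed subspace, so that vectors can be projected onto it.
  Scaling passes to limits by \<open>norm_scale\<close>.\<close>

lemma subspace_closure:
  assumes "subspace S"
  shows "subspace (closure S)"
proof (rule subspaceI)
  show "0 \<in> closure S"
    using subspace_0[OF assms] closure_subset by blast
next
  fix x y
  assume "x \<in> closure S" "y \<in> closure S"
  then obtain f g where "\<forall>n. f n \<in> S" "f \<longlonglongrightarrow> x" "\<forall>n. g n \<in> S" "g \<longlonglongrightarrow> y"
    unfolding closure_sequential by blast
  then have "\<forall>n. f n + g n \<in> S" "(\<lambda>n. f n + g n) \<longlonglongrightarrow> x + y"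
    using subspace_add[OF assms] by (auto intro: tendsto_add)
  then show "x + y \<in> closure S"
    unfolding closure_sequential by (intro exI[of _ "\<lambda>n. f n + g n"]) blast
next
  fix c :: 'k and x
  assume "x \<in> closure S"
  then obtain f where f: "\<forall>n. f n \<in> S" "f \<longlonglongrightarrow> x"
    unfolding closure_sequential by blast
  have "(\<lambda>n. norm c * norm (f n - x)) \<longlonglongrightarrow> norm c * 0"
    using f(2) by (intro tendsto_mult_left tendsto_norm_zero) (simp add: LIM_zero)
  then have "(\<lambda>n. norm (scaleK c (f n) - scaleK c x)) \<longlonglongrightarrow> 0"
    by (simp flip: scale_right_diff_distrib add: norm_scale)
  then have "(\<lambda>n. scaleK c (f n)) \<longlonglongrightarrow> scaleK c x"
    by (simp add: LIM_zero_iff tendsto_norm_zero_iff)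
  moreover have "\<forall>n. scaleK c (f n) \<in> S"
    using f(1) subspace_scale[OF assms] by blast
  ultimately show "scaleK c x \<in> closure S"
    unfolding closure_sequential by (intro exI[of _ "\<lambda>n. scaleK c (f n)"]) blast
qed

section \<open>Existence, uniqueness and basic properties of orthogonal projections\<close>

text \<open>If \<open>x - p\<close> had a nonzero component along \<open>w\<close>, removing it
  would shorten the vector by Pythagoras. But the result is the difference of \<open>x\<close> and
  another point of \<open>W\<close>, contradicting minimality.\<close>

lemma closest_point_orthogonal:
  assumes "subspace W" "p \<in> W" "\<And>w. w \<in> W \<Longrightarrow> norm (x - p) \<le> norm (x - w)" "w \<in> W"
  shows "ip (x - p) w = 0"
proof (cases "w = 0")
  case False
  \<comment> \<open>The coefficient for which the remainder \<open>u\<close> is orthogonal to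
    \<open>w\<close>.\<close>
  define c where "c = ip (x - p) w / ip w w"
  define u where "u = x - p - scaleK c w"
  have u: "ip u w = 0"
    using False by (simp add: u_def c_def inner_diff_left inner_scale_left inner_self_eq_0_iff)
  then have "ip u (scaleK c w) = 0"
    by (metis orthogonal_sym inner_scale_left mult_zero_right)
  from pythagoras[OF this] have "(norm (x - p))\<^sup>2 = (norm u)\<^sup>2 + (norm (scaleK c w))\<^sup>2"
    by (simp add: u_def)
  moreover have "norm (x - p) \<le> norm u"
    using assms(3)[of "p + scaleK c w"] assms
    by (simp add: u_def subspace_add subspace_scale algebra_simps)
  then have "(norm (x - p))\<^sup>2 \<le> (norm u)\<^sup>2"
    by simp
  ultimately have "scaleK c w = 0"
    by simp
  with u show ?thesis
    by (simp add: u_def)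
qed simp

text \<open>A minimising sequence is Cauchy by the parallelogram law.\<close>

lemma closest_point_exists:
  assumes W: "subspace W" "closed W"
  shows "\<exists>p\<in>W. \<forall>w\<in>W. norm (x - p) \<le> norm (x - w)"
proof -
  define D where "D = (\<lambda>w. (norm (x - w))\<^sup>2) ` W"
  define d where "d = Inf D"
  have "0 \<in> W"
    using W by (rule_tac subspace_0)
  then have ne: "D \<noteq> {}"
    by (auto simp: D_def)
  have bdd: "bdd_below D"
    by (rule bdd_belowI[of _ 0]) (auto simp: D_def)
  have d_le: "d \<le> (norm (x - w))\<^sup>2" if "w \<in> W" for w
    using that bdd by (auto simp: d_def D_def intro: cInf_lower)
  have "\<exists>w\<in>W. (norm (x - w))\<^sup>2 < d + inverse (Suc k)" for k
  proof -
    have "\<exists>r\<in>D. r < d + inverse (Suc k)"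
      using cInf_less_iff[OF ne bdd, of "d + inverse (Suc k)"] by (simp add: d_def)
    then show ?thesis
      by (auto simp: D_def)
  qed
  then obtain w where w: "\<And>k. w k \<in> W" "\<And>k. (norm (x - w k))\<^sup>2 < d + inverse (Suc k)"
    by metis
  have close: "(norm (w j - w k))\<^sup>2 \<le> 2 * inverse (Suc j) + 2 * inverse (Suc k)" for j k
  proof -
    \<comment> \<open>The midpoint lies in \<open>W\<close>, so \<open>d_le\<close> bounds its
      squared distance to \<open>x\<close> from below by \<open>d\<close>. In the parallelogram law
      this cancels the \<open>4 * d\<close> coming from the two sides and leaves only the error
      terms.\<close>
    define m where "m = (1/2) *\<^sub>R (w j + w k)"
    have "m = scaleK (of_real (1/2)) (w j + w k)"
      by (simp add: m_def scale_of_real del: of_real_divide)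
    then have "m \<in> W"
      using W w by (simp add: subspace_add subspace_scale)
    have "(x - w j) + (x - w k) = 2 *\<^sub>R (x - m)"
      by (simp add: m_def algebra_simps scaleR_2)
    then have "norm ((x - w j) + (x - w k)) = 2 * norm (x - m)"
      by simp
    then have "4 * (norm (x - m))\<^sup>2 + (norm ((x - w j) - (x - w k)))\<^sup>2
        = 2 * (norm (x - w j))\<^sup>2 + 2 * (norm (x - w k))\<^sup>2"
      using parallelogram[of "x - w j" "x - w k"] by (simp add: power_mult_distrib)
    moreover have "norm ((x - w j) - (x - w k)) = norm (w j - w k)"
      by (simp add: norm_minus_commute)
    ultimately show ?thesis
      using w(2)[of j] w(2)[of k] d_le[OF \<open>m \<in> W\<close>] by simp
  qed
  have "Cauchy w"
  proof (rule CauchyI)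
    fix e :: real
    assume "e > 0"
    \<comment> \<open>Four such errors, two for each index in \<open>close\<close>, add up to less
      than the square of \<open>e\<close>.\<close>
    then obtain M where M: "inverse (Suc M) < e\<^sup>2 / 4"
      using reals_Archimedean[of "e\<^sup>2 / 4"] by auto
    have "norm (w j - w k) < e" if "j \<ge> M" "k \<ge> M" for j k
    proof -
      have "inverse (real (Suc j)) \<le> inverse (Suc M)" "inverse (real (Suc k)) \<le> inverse (Suc M)"
        using that by (auto intro!: le_imp_inverse_le)
      then have "(norm (w j - w k))\<^sup>2 < e\<^sup>2"
        using close[of j k] M by linarith
      then show ?thesis
        using \<open>e > 0\<close> by (simp add: power_less_imp_less_base)
    qed
    then show "\<exists>M. \<forall>m\<ge>M. \<forall>n\<ge>M. norm (w m - w n) < e"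
      by blast
  qed
  then obtain p where p: "w \<longlonglongrightarrow> p"
    using Cauchy_convergent convergent_def by blast
  have "p \<in> W"
    using W(2) w(1) p closed_sequential_limits by blast
  have "(\<lambda>k. (norm (x - w k))\<^sup>2) \<longlonglongrightarrow> (norm (x - p))\<^sup>2"
    using p by (intro tendsto_intros)
  moreover have "(\<lambda>k. d + inverse (real (Suc k))) \<longlonglongrightarrow> d + 0"
    by (intro tendsto_intros LIMSEQ_inverse_real_of_nat)
  \<comment> \<open>The limit \<open>p\<close> attains the infimum of the squared distances.\<close>
  ultimately have "(norm (x - p))\<^sup>2 \<le> d + 0"
    by (rule LIMSEQ_le) (use w(2) less_imp_le in blast)
  then have "norm (x - p) \<le> norm (x - u)" if "u \<in> W" for u
    using order_trans[OF _ d_le[OF that]] by (metis add_0_right norm_ge_zero power2_le_imp_le)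
  with \<open>p \<in> W\<close> show ?thesis
    by blast
qed

text \<open>The difference of two candidates is orthogonal to \<open>W\<close>, hence to both
  candidates and therefore to itself.\<close>

lemma orth_proj_unique:
  assumes "p \<in> W" "\<And>w. w \<in> W \<Longrightarrow> ip (x - p) w = 0"
  shows "orth_proj ip W x = p"
  unfolding orth_proj_def
proof (rule the_equality)
  fix q
  assume q: "q \<in> W \<and> (\<forall>w\<in>W. ip (x - q) w = 0)"
  have "ip (q - p) w = 0" if "w \<in> W" for w
    using assms(2)[OF that] q that by (simp add: inner_diff_left)
  then have "ip (q - p) (q - p) = 0"
    using q assms(1) by (simp add: inner_diff_right)
  then show "q = p"
    by (simp add: inner_self_eq_0_iff)
qed (use assms in blast)

text \<open>Justifies the definite description in \<open>orth_proj\<close>: the closest point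
  satisfies the defining condition, and \<open>orth_proj_unique\<close> identifies it with the
  described value.\<close>

lemma orth_proj:
  assumes "closed_subspace scaleK W"
  shows orth_proj_in: "orth_proj ip W x \<in> W"
    and orth_proj_orthogonal: "w \<in> W \<Longrightarrow> ip (x - orth_proj ip W x) w = 0"
proof -
  have W: "subspace W" "closed W"
    using assms by (auto simp: closed_subspace_def)
  obtain p where "p \<in> W" "\<And>w. w \<in> W \<Longrightarrow> norm (x - p) \<le> norm (x - w)"
    using closest_point_exists[OF W] by blast
  then have p: "p \<in> W" "\<And>w. w \<in> W \<Longrightarrow> ip (x - p) w = 0"
    using closest_point_orthogonal[OF W(1)] by blast+
  then show "orth_proj ip W x \<in> W" "w \<in> W \<Longrightarrow> ip (x - orth_proj ip W x) w = 0"
    using orth_proj_unique[of p W x] by auto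
qed

lemma orth_proj_id: "x \<in> W \<Longrightarrow> orth_proj ip W x = x"
  by (rule orth_proj_unique) auto

lemma norm_orth_proj_le:
  assumes "closed_subspace scaleK W"
  shows "norm (orth_proj ip W x) \<le> norm x"
proof -
  have "(norm x)\<^sup>2 = (norm (x - orth_proj ip W x))\<^sup>2 + (norm (orth_proj ip W x))\<^sup>2"
    using pythagoras[OF orth_proj_orthogonal[OF assms orth_proj_in[OF assms], of x x]] by simp
  then show ?thesis
    by (simp add: power2_le_imp_le)
qed

lemma orth_proj_scale:
  assumes "closed_subspace scaleK W"
  shows "orth_proj ip W (scaleK c x) = scaleK c (orth_proj ip W x)"
proof (rule orth_proj_unique)
  show "scaleK c (orth_proj ip W x) \<in> W"
    using assms orth_proj_in[OF assms] by (simp add: closed_subspace_def subspace_scale)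
  show "ip (scaleK c x - scaleK c (orth_proj ip W x)) w = 0" if "w \<in> W" for w
    using orth_proj_orthogonal[OF assms that]
    by (simp flip: scale_right_diff_distrib add: inner_scale_left)
qed

section \<open>Unitary operators, projections and the unit sphere\<close>

lemma orth_proj_unitary:
  assumes U: "unitary_operator scaleK ip U" and W: "closed_subspace scaleK W"
  shows "orth_proj ip (U ` W) (U x) = U (orth_proj ip W x)"
proof -
  interpret U: Vector_Spaces.linear scaleK scaleK U
    using U by (simp add: unitary_operator_def)
  show ?thesis
  proof (rule orth_proj_unique)
    fix w
    assume "w \<in> U ` W"
    then show "ip (U x - U (orth_proj ip W x)) w = 0"
      using U orth_proj_orthogonal[OF W] by (auto simp: unitary_operator_def simp flip: U.diff)
  qed (use orth_proj_in[OF W] in blast)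
qed

lemma norm_unitary:
  assumes "unitary_operator scaleK ip U"
  shows "norm (U x) = norm x"
proof -
  have "of_real ((norm (U x))\<^sup>2) = (of_real ((norm x)\<^sup>2) :: 'k)"
    using assms by (simp only: unitary_operator_def flip: inner_self)
  then have "(norm (U x))\<^sup>2 = (norm x)\<^sup>2"
    by (simp only: of_real_eq_iff)
  then show ?thesis
    by simp
qed

lemma unitary_image_sphere:
  assumes "unitary_operator scaleK ip U"
  shows "U ` sphere 0 1 = sphere 0 1"
proof
  show "U ` sphere 0 1 \<subseteq> sphere 0 1"
    using norm_unitary[OF assms] by auto
  have "x \<in> U ` sphere 0 1" if "norm x = 1" for x
  proof -
    obtain y where "x = U y"
      using assms unfolding unitary_operator_def by (metis surjD)
    with that show ?thesis
      using norm_unitary[OF assms] by auto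
  qed
  then show "sphere 0 1 \<subseteq> U ` sphere 0 1"
    by auto
qed

section \<open>Orthogonal sums, and orthogonality to spans and closures\<close>

lemma norm_sum_orthogonal:
  assumes "finite I" "\<And>i j. i \<in> I \<Longrightarrow> j \<in> I \<Longrightarrow> i \<noteq> j \<Longrightarrow> ip (f i) (f j) = 0"
  shows "(norm (\<Sum>i\<in>I. f i))\<^sup>2 = (\<Sum>i\<in>I. (norm (f i))\<^sup>2)"
  using assms
proof (induction I)
  case (insert a I)
  have "ip (f a) (\<Sum>i\<in>I. f i) = 0"
    using insert by (auto simp: inner_sum_right intro!: sum.neutral)
  from pythagoras[OF this] show ?case
    using insert by simp
qed simp

lemma orthogonal_span:
  assumes "\<And>s. s \<in> S \<Longrightarrow> ip z s = 0" "s \<in> span S"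
  shows "ip z s = 0"
proof -
  \<comment> \<open>The induction runs in the first argument because \<open>ip\<close> is linear
    there.\<close>
  have "ip s z = 0"
    using assms(2)
    by (induction rule: span_induct_alt)
      (auto simp: inner_add_left inner_scale_left intro: orthogonal_sym assms(1))
  then show ?thesis
    by (rule orthogonal_sym)
qed

text \<open>By Pythagoras, every vector orthogonal to \<open>z\<close> has distance at least
  \<open>norm z\<close> from \<open>z\<close>. Such vectors can approximate \<open>z\<close> only if
  it is zero.\<close>

lemma orthogonal_closure_eq_0:
  assumes "\<And>s. s \<in> S \<Longrightarrow> ip z s = 0" "z \<in> closure S"
  shows "z = 0"
proof (rule ccontr)
  assume "z \<noteq> 0"
  then obtain s where s: "s \<in> S" "dist s z < norm z"
    using assms(2) by (metis closure_approachable zero_less_norm_iff)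
  have "ip z (- s) = 0"
    using assms(1)[OF s(1)] inner_diff_right[of z 0 s] by simp
  from pythagoras[OF this] have "(norm z)\<^sup>2 \<le> (norm (z - s))\<^sup>2"
    by simp
  then have "norm z \<le> norm (z - s)"
    by (rule power2_le_imp_le) simp
  with s(2) show False
    by (simp add: dist_norm norm_minus_commute)
qed

section \<open>The redundancy function and its extreme values on the unit sphere\<close>

lemma redundancy_scale:
  assumes "\<And>i. i \<in> I \<Longrightarrow> closed_subspace scaleK (fst (F i))"
  shows "redundancy ip I F (scaleK c x) = (norm c)\<^sup>2 * redundancy ip I F x"
  using assms
  by (simp add: redundancy_def orth_proj_scale norm_scale power_mult_distrib sum_distrib_left
      cong: sum.cong)

text \<open>Constancy on the unit sphere spreads to all vectors because the redundancy is
  homogeneous of degree two.\<close>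

lemma redundancy_homogeneous:
  assumes "\<And>i. i \<in> I \<Longrightarrow> closed_subspace scaleK (fst (F i))"
    and "\<And>x. norm x = 1 \<Longrightarrow> redundancy ip I F x = A"
  shows "redundancy ip I F x = A * (norm x)\<^sup>2"
proof (cases "x = 0")
  case True
  then show ?thesis
    using redundancy_scale[of I F, OF assms(1), where c = 0 and x = 0] by simp
next
  case False
  define y where "y = inverse (norm x) *\<^sub>R x"
  have "x = scaleK (of_real (norm x)) y" "norm y = 1"
    using False by (simp_all add: y_def scale_of_real)
  then show ?thesis
    using redundancy_scale[of I F, OF assms(1), where c = "of_real (norm x)" and x = y]
      assms(2)[of y] by (simp add: mult.commute)
qed

lemma redundancy_le_card:
  assumes "\<And>i. i \<in> I \<Longrightarrow> closed_subspace scaleK (fst (F i))" "norm x = 1"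
  shows "redundancy ip I F x \<le> card I"
proof -
  have "(norm (orth_proj ip (fst (F i)) x))\<^sup>2 \<le> 1" if "i \<in> I" for i
    using norm_orth_proj_le[OF assms(1)[OF that], of x] assms(2) by (simp add: power_le_one)
  from sum_bounded_above[of I _ 1, OF this] show ?thesis
    by (simp add: redundancy_def)
qed

text \<open>Suprema and infima of reals carry information only for bounded sets. Projections do not
  increase norms, which bounds the redundancy on the sphere by the number of subspaces.\<close>

lemma bdd_redundancy:
  assumes "\<And>i. i \<in> I \<Longrightarrow> closed_subspace scaleK (fst (F i))"
  shows "bdd_above (redundancy ip I F ` sphere 0 1)" "bdd_below (redundancy ip I F ` sphere 0 1)"
proof -
  show "bdd_above (redundancy ip I F ` sphere 0 1)"
    using redundancy_le_card[OF assms] by (auto intro!: bdd_aboveI2)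
  show "bdd_below (redundancy ip I F ` sphere 0 1)"
    by (auto intro!: bdd_belowI2[of _ 0] sum_nonneg simp: redundancy_def)
qed

lemma lower_redundancy_le:
  assumes "\<And>i. i \<in> I \<Longrightarrow> closed_subspace scaleK (fst (F i))" "norm x = 1"
  shows "lower_redundancy ip I F \<le> redundancy ip I F x"
  unfolding lower_redundancy_def
  using bdd_redundancy(2)[of I F, OF assms(1)] assms(2) by (auto intro: cINF_lower)

lemma upper_redundancy_ge:
  assumes "\<And>i. i \<in> I \<Longrightarrow> closed_subspace scaleK (fst (F i))" "norm x = 1"
  shows "redundancy ip I F x \<le> upper_redundancy ip I F"
  unfolding upper_redundancy_def
  using bdd_redundancy(1)[of I F, OF assms(1)] assms(2) by (auto intro: cSUP_upper)

text \<open>Turns both equivalences about extreme redundancies into pointwise statements. On a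
  nonempty sphere a constant function has a one-point image, whose infimum and supremum are that
  constant.\<close>

lemma redundancy_bounds_eq_iff:
  assumes "\<And>i. i \<in> I \<Longrightarrow> closed_subspace scaleK (fst (F i))" "sphere (0::'a) 1 \<noteq> {}"
  shows "lower_redundancy ip I F = A \<and> upper_redundancy ip I F = A
    \<longleftrightarrow> (\<forall>x. norm x = 1 \<longrightarrow> redundancy ip I F x = A)"
proof
  assume "lower_redundancy ip I F = A \<and> upper_redundancy ip I F = A"
  then show "\<forall>x. norm x = 1 \<longrightarrow> redundancy ip I F x = A"
    using lower_redundancy_le[of I F, OF assms(1)] upper_redundancy_ge[of I F, OF assms(1)]
    by (metis order_antisym)
next
  assume "\<forall>x. norm x = 1 \<longrightarrow> redundancy ip I F x = A"
  then have "redundancy ip I F ` sphere 0 1 = {A}"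
    using assms(2) by auto
  then show "lower_redundancy ip I F = A \<and> upper_redundancy ip I F = A"
    by (simp add: lower_redundancy_def upper_redundancy_def)
qed

section \<open>Fusion frames and tightness of the normalized family\<close>

lemma fusion_frameD:
  assumes "fusion_frame scaleK ip I F" "i \<in> I"
  shows "closed_subspace scaleK (fst (F i))" "snd (F i) > 0"
  using assms by (auto simp: fusion_frame_def fusion_frame_bounds_def)

text \<open>The lower frame bound makes the weighted sum positive, so some projection of
  \<open>x\<close> is nonzero, and this survives dropping the weights.\<close>

lemma fusion_frame_redundancy_pos:
  assumes F: "fusion_frame scaleK ip I F" and "finite I" "x \<noteq> 0"
  shows "redundancy ip I F x > 0"
proof -
  obtain A B where AB: "fusion_frame_bounds scaleK ip I F A B"
    using F by (auto simp: fusion_frame_def)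
  then have "A > 0"
    and "A * (norm x)\<^sup>2 \<le> (\<Sum>i\<in>I. (snd (F i))\<^sup>2 * (norm (orth_proj ip (fst (F i)) x))\<^sup>2)"
    using \<open>finite I\<close> by (auto simp: fusion_frame_bounds_def)
  moreover from this \<open>x \<noteq> 0\<close> have "0 < A * (norm x)\<^sup>2"
    by simp
  ultimately have "(\<Sum>i\<in>I. (snd (F i))\<^sup>2 * (norm (orth_proj ip (fst (F i)) x))\<^sup>2) \<noteq> 0"
    by linarith
  then obtain i where "i \<in> I" "norm (orth_proj ip (fst (F i)) x) \<noteq> 0"
    by (force intro: sum.neutral)
  then show ?thesis
    unfolding redundancy_def using \<open>finite I\<close> by (intro sum_pos2[of I i]) auto
qed

text \<open>With unit weights the frame sum is the redundancy, and equal bounds turn the two frame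
  inequalities into an equation. The positivity of \<open>A\<close> demanded by tightness comes from
  the frame property of \<open>F\<close> at a unit vector.\<close>

lemma tight_normalized_iff:
  assumes F: "fusion_frame scaleK ip I F" and "finite I" and ne: "sphere (0::'a) 1 \<noteq> {}"
  shows "tight_fusion_frame scaleK ip A I (normalized F)
    \<longleftrightarrow> lower_redundancy ip I F = A \<and> upper_redundancy ip I F = A"
proof -
  note sub = fusion_frameD(1)[OF F]
  have tight: "tight_fusion_frame scaleK ip A I (normalized F)
      \<longleftrightarrow> 0 < A \<and> (\<forall>x. redundancy ip I F x = A * (norm x)\<^sup>2)"
    using \<open>finite I\<close> sub
    by (auto simp: tight_fusion_frame_def fusion_frame_bounds_def normalized_def redundancy_def
        countable_finite order_antisym)
  have pos: "0 < A" if "\<forall>x. norm x = 1 \<longrightarrow> redundancy ip I F x = A"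
  proof -
    obtain x :: 'a where "norm x = 1"
      using ne by auto
    then show ?thesis
      using fusion_frame_redundancy_pos[OF F \<open>finite I\<close>, of x] that by force
  qed
  show ?thesis
    using tight pos redundancy_bounds_eq_iff[of I F A, OF sub ne]
      redundancy_homogeneous[of I F A, OF sub]
    by (metis mult.right_neutral one_power2)
qed

section \<open>Orthonormal fusion bases characterised by redundancy one\<close>

text \<open>The vector \<open>x\<close> is the sum of its projections, because the difference is
  orthogonal to a dense subspace. The projections are pairwise orthogonal, so their squared norms
  add up.\<close>

lemma redundancy_orthonormal_fusion_basis:
  assumes E: "orthonormal_fusion_basis scaleK ip I E" and "finite I"
  shows "redundancy ip I E x = (norm x)\<^sup>2"
proof -
  define P where "P i = orth_proj ip (fst (E i)) x" for i
  have sub: "closed_subspace scaleK (fst (E i))" if "i \<in> I" for i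
    using E that by (simp add: orthonormal_fusion_basis_def)
  have orth: "ip y z = 0" if "i \<in> I" "j \<in> I" "i \<noteq> j" "y \<in> fst (E i)" "z \<in> fst (E j)" for i j y z
    using E that by (auto simp: orthonormal_fusion_basis_def)
  have dense: "closure (span (\<Union>i\<in>I. fst (E i))) = UNIV"
    using E by (simp add: orthonormal_fusion_basis_def)
  have P: "P i \<in> fst (E i)" "w \<in> fst (E i) \<Longrightarrow> ip (x - P i) w = 0" if "i \<in> I" for i w
    using orth_proj[OF sub[OF that]] by (auto simp: P_def)
  have "ip (x - (\<Sum>i\<in>I. P i)) w = 0" if w: "w \<in> (\<Union>i\<in>I. fst (E i))" for w
  proof -
    obtain j where j: "j \<in> I" "w \<in> fst (E j)"
      using w by blast
    \<comment> \<open>Only \<open>P j\<close> can have a nonzero inner product with a vector of the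
      \<open>j\<close>-th subspace, and there it agrees with \<open>x\<close>.\<close>
    have "(\<Sum>i\<in>I. ip (P i) w) = ip (P j) w + (\<Sum>i\<in>I - {j}. ip (P i) w)"
      using j \<open>finite I\<close> by (simp add: sum.remove)
    also have "(\<Sum>i\<in>I - {j}. ip (P i) w) = 0"
      using j P orth by (intro sum.neutral) blast
    finally show ?thesis
      using P(2)[OF j] by (simp add: inner_diff_left inner_sum_left)
  qed
  then have "x - (\<Sum>i\<in>I. P i) = 0"
    using dense by (intro orthogonal_closure_eq_0[of "span (\<Union>i\<in>I. fst (E i))"])
      (blast intro: orthogonal_span, simp)
  moreover have "(norm (\<Sum>i\<in>I. P i))\<^sup>2 = (\<Sum>i\<in>I. (norm (P i))\<^sup>2)"
    using orth P(1) by (intro norm_sum_orthogonal \<open>finite I\<close>) blast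
  ultimately show ?thesis
    by (simp add: redundancy_def P_def)
qed

text \<open>Stating \<open>R\<close> for all vectors allows its use on arbitrary elements of a
  subspace and on the residual \<open>z\<close> below without normalising them.\<close>

lemma orthonormal_fusion_basisI:
  assumes sub: "\<And>i. i \<in> I \<Longrightarrow> closed_subspace scaleK (fst (F i))"
    and "finite I" and one: "\<And>i. i \<in> I \<Longrightarrow> snd (F i) = 1"
    and R: "\<And>x. redundancy ip I F x = (norm x)\<^sup>2"
  shows "orthonormal_fusion_basis scaleK ip I F"
proof -
  have orth: "ip x y = 0"
    if "i \<in> I" "j \<in> I" "i \<noteq> j" "x \<in> fst (F i)" "y \<in> fst (F j)" for i j x y
  proof -
    \<comment> \<open>Since \<open>x\<close> is its own projection onto the \<open>i\<close>-th
      subspace, that term is already the whole sum, so the others vanish.\<close>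
    have "(norm x)\<^sup>2 = (norm (orth_proj ip (fst (F i)) x))\<^sup>2
        + (\<Sum>k\<in>I - {i}. (norm (orth_proj ip (fst (F k)) x))\<^sup>2)"
      using R[of x] that \<open>finite I\<close> by (simp add: redundancy_def sum.remove)
    then have "(\<Sum>k\<in>I - {i}. (norm (orth_proj ip (fst (F k)) x))\<^sup>2) = 0"
      by (simp add: orth_proj_id[OF \<open>x \<in> fst (F i)\<close>])
    then have "orth_proj ip (fst (F j)) x = 0"
      using that \<open>finite I\<close> by (auto simp: sum_nonneg_eq_0_iff)
    then show ?thesis
      using orth_proj_orthogonal[OF sub[OF \<open>j \<in> I\<close>] that(5), of x] by simp
  qed
  let ?S = "closure (span (\<Union>i\<in>I. fst (F i)))"
  have S: "closed_subspace scaleK ?S"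
    by (simp add: closed_subspace_def subspace_closure)
  have "x \<in> ?S" for x
  proof -
    \<comment> \<open>This residual is orthogonal to every subspace of the family, so its redundancy
      is zero and \<open>R\<close> gives \<open>z = 0\<close>.\<close>
    define z where "z = x - orth_proj ip ?S x"
    have "orth_proj ip (fst (F i)) z = 0" if "i \<in> I" for i
    proof (rule orth_proj_unique)
      show "0 \<in> fst (F i)"
        using sub[OF that] by (simp add: closed_subspace_def subspace_0)
      show "ip (z - 0) w = 0" if "w \<in> fst (F i)" for w
      proof -
        have "w \<in> ?S"
          using that \<open>i \<in> I\<close> by (intro subsetD[OF closure_subset] span_base) blast
        then show ?thesis
          using orth_proj_orthogonal[OF S] by (simp add: z_def)
      qed
    qed
    then have "redundancy ip I F z = 0"
      by (simp add: redundancy_def)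
    with R[of z] have "x = orth_proj ip ?S x"
      by (simp add: z_def)
    then show ?thesis
      using orth_proj_in[OF S, of x] by simp
  qed
  then show ?thesis
    using sub one orth unfolding orthonormal_fusion_basis_def by blast
qed

lemma orthonormal_fusion_basis_iff:
  assumes F: "fusion_frame scaleK ip I F" and "finite I" and ne: "sphere (0::'a) 1 \<noteq> {}"
  shows "orthonormal_fusion_basis scaleK ip I F
    \<longleftrightarrow> lower_redundancy ip I F = 1 \<and> upper_redundancy ip I F = 1 \<and> (\<forall>i\<in>I. snd (F i) = 1)"
proof -
  note sub = fusion_frameD(1)[OF F]
  have iff: "lower_redundancy ip I F = 1 \<and> upper_redundancy ip I F = 1
      \<longleftrightarrow> (\<forall>x. norm x = 1 \<longrightarrow> redundancy ip I F x = 1)"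
    by (rule redundancy_bounds_eq_iff[OF sub ne])
  show ?thesis
  proof
    assume E: "orthonormal_fusion_basis scaleK ip I F"
    then show "lower_redundancy ip I F = 1 \<and> upper_redundancy ip I F = 1 \<and> (\<forall>i\<in>I. snd (F i) = 1)"
      using iff redundancy_orthonormal_fusion_basis[OF E \<open>finite I\<close>]
      by (auto simp: orthonormal_fusion_basis_def)
  next
    assume *: "lower_redundancy ip I F = 1 \<and> upper_redundancy ip I F = 1
      \<and> (\<forall>i\<in>I. snd (F i) = 1)"
    then have "redundancy ip I F x = (norm x)\<^sup>2" for x
      using iff redundancy_homogeneous[of I F 1 x, OF sub] by auto
    then show "orthonormal_fusion_basis scaleK ip I F"
      using sub * \<open>finite I\<close> by (intro orthonormal_fusion_basisI) auto
  qed
qed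

section \<open>Redundancies of unions\<close>

lemma redundancy_family_union:
  assumes "finite I" "finite J"
  shows "redundancy ip (I <+> J) (family_union F G) x = redundancy ip I F x + redundancy ip J G x"
  using assms by (simp add: redundancy_def family_union_def sum.Plus)

text \<open>The redundancy is additive at each unit vector, but the two infima may belong to
  different vectors, which leaves an inequality. The same holds for suprema in the next
  lemma.\<close>

lemma lower_redundancy_union_ge:
  assumes "\<And>i. i \<in> I \<Longrightarrow> closed_subspace scaleK (fst (F i))" "finite I"
    and "\<And>j. j \<in> J \<Longrightarrow> closed_subspace scaleK (fst (G j))" "finite J"
    and ne: "sphere (0::'a) 1 \<noteq> {}"
  shows "lower_redundancy ip I F + lower_redundancy ip J G
    \<le> lower_redundancy ip (I <+> J) (family_union F G)"
  unfolding lower_redundancy_def[of ip "I <+> J"] redundancy_family_union[OF assms(2,4)]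
  using lower_redundancy_le[of I F, OF assms(1)] lower_redundancy_le[of J G, OF assms(3)]
  by (intro cINF_greatest ne) (auto intro: add_mono)

lemma upper_redundancy_union_le:
  assumes "\<And>i. i \<in> I \<Longrightarrow> closed_subspace scaleK (fst (F i))" "finite I"
    and "\<And>j. j \<in> J \<Longrightarrow> closed_subspace scaleK (fst (G j))" "finite J"
    and ne: "sphere (0::'a) 1 \<noteq> {}"
  shows "upper_redundancy ip (I <+> J) (family_union F G)
    \<le> upper_redundancy ip I F + upper_redundancy ip J G"
  unfolding upper_redundancy_def[of ip "I <+> J"] redundancy_family_union[OF assms(2,4)]
  using upper_redundancy_ge[of I F, OF assms(1)] upper_redundancy_ge[of J G, OF assms(3)]
  by (intro cSUP_least ne) (auto intro: add_mono)

text \<open>The redundancy functions of the union and of the first family differ by a constant.\<close>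

lemma redundancy_union_uniform:
  assumes F: "\<And>i. i \<in> I \<Longrightarrow> closed_subspace scaleK (fst (F i))" "finite I"
    and G: "\<And>j. j \<in> J \<Longrightarrow> closed_subspace scaleK (fst (G j))" "finite J"
    and ne: "sphere (0::'a) 1 \<noteq> {}"
    and c: "lower_redundancy ip J G = c" "upper_redundancy ip J G = c"
  shows "lower_redundancy ip (I <+> J) (family_union F G) = lower_redundancy ip I F + c"
    and "upper_redundancy ip (I <+> J) (family_union F G) = upper_redundancy ip I F + c"
proof -
  let ?K = "I <+> J" and ?H = "family_union F G"
  have sub: "closed_subspace scaleK (fst (?H k))" if "k \<in> ?K" for k
    using that F(1) G(1) by (auto simp: family_union_def)
  \<comment> \<open>Equal extreme values force the redundancy of \<open>G\<close> to be
    \<open>c\<close> at every unit vector.\<close>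
  have R: "redundancy ip ?K ?H x = redundancy ip I F x + c" if "norm x = 1" for x
    using redundancy_bounds_eq_iff[of J G c, OF G(1) ne] c that
    by (simp add: redundancy_family_union[OF F(2) G(2)])
  \<comment> \<open>This is the direction missing from \<open>lower_redundancy_union_ge\<close>: by
    \<open>R\<close>, the left side is a lower bound for the redundancy of \<open>F\<close>.\<close>
  have "lower_redundancy ip ?K ?H - c \<le> lower_redundancy ip I F"
    unfolding lower_redundancy_def[of ip I]
    using lower_redundancy_le[of ?K ?H, OF sub] R by (intro cINF_greatest ne) force
  then show "lower_redundancy ip ?K ?H = lower_redundancy ip I F + c"
    using lower_redundancy_union_ge[of I F J G, OF F G ne] c by simp
  have "upper_redundancy ip I F \<le> upper_redundancy ip ?K ?H - c"
    unfolding upper_redundancy_def[of ip I]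
    using upper_redundancy_ge[of ?K ?H, OF sub] R by (intro cSUP_least ne) force
  then show "upper_redundancy ip ?K ?H = upper_redundancy ip I F + c"
    using upper_redundancy_union_le[of I F J G, OF F G ne] c by simp
qed

section \<open>Invariance, and existence of unit vectors\<close>

text \<open>The image family takes at \<open>U x\<close> the value that \<open>F\<close> takes at
  \<open>x\<close>. As \<open>U\<close> maps the unit sphere onto itself, both families have the
  same set of values there.\<close>

lemma redundancy_bounds_unitary:
  assumes U: "unitary_operator scaleK ip U"
    and sub: "\<And>i. i \<in> I \<Longrightarrow> closed_subspace scaleK (fst (F i))"
  shows "lower_redundancy ip I (family_image U F) = lower_redundancy ip I F"
    and "upper_redundancy ip I (family_image U F) = upper_redundancy ip I F"
proof -
  have "redundancy ip I (family_image U F) (U x) = redundancy ip I F x" for x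
    using sub by (simp add: redundancy_def family_image_def orth_proj_unitary[OF U] norm_unitary[OF U])
  then have "redundancy ip I (family_image U F) ` U ` sphere 0 1 = redundancy ip I F ` sphere 0 1"
    by (simp add: image_image)
  then show "lower_redundancy ip I (family_image U F) = lower_redundancy ip I F"
    and "upper_redundancy ip I (family_image U F) = upper_redundancy ip I F"
    by (simp_all add: lower_redundancy_def upper_redundancy_def unitary_image_sphere[OF U])
qed

text \<open>Here positive dimension enters: a space without nonzero vectors is the span of the empty
  set and has dimension zero. It keeps the infima and suprema from ranging over the empty
  set.\<close>

lemma sphere_nonempty:
  assumes "dim (UNIV :: 'a set) \<ge> 1"
  shows "sphere (0::'a) 1 \<noteq> {}"
proof -
  have "\<exists>x::'a. x \<noteq> 0"
  proof (rule ccontr)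
    assume "\<nexists>x::'a. x \<noteq> 0"
    then have "(UNIV :: 'a set) = span {}"
      by auto
    with assms show False
      using dim_span[of "{}"] dim_eq_card_independent[OF independent_empty] by simp
  qed
  then obtain x :: 'a where "x \<noteq> 0"
    by blast
  then have "inverse (norm x) *\<^sub>R x \<in> sphere 0 1"
    by simp
  then show ?thesis
    by blast
qed

end

lemma redundancy_permutes:
  assumes "\<pi> permutes I"
  shows "redundancy ip I (\<lambda>i. F (\<pi> i)) = redundancy ip I F"
  using sum.permute[OF assms, of "\<lambda>i. (norm (orth_proj ip (fst (F i)) _))\<^sup>2"]
  by (simp add: redundancy_def fun_eq_iff comp_def)

theorem proposition3p3:
  fixes scaleK :: "'k::real_or_complex \<Rightarrow> 'a::banach \<Rightarrow> 'a"
    and ip :: "'a \<Rightarrow> 'a \<Rightarrow> 'k"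
    and n N :: nat
    and W :: "(nat, 'a) weighted_family"
  assumes "hilbert_space scaleK ip"
    and "n \<ge> 1"
    and "vector_space.dim scaleK (UNIV :: 'a set) = n"
    and "fusion_frame scaleK ip {1..N} W"
  shows
    "(\<forall>A::real. tight_fusion_frame scaleK ip A {1..N} (normalized W) \<longleftrightarrow>
        lower_redundancy ip {1..N} W = A \<and> upper_redundancy ip {1..N} W = A)
     \<and>
     (orthonormal_fusion_basis scaleK ip {1..N} W \<longleftrightarrow>
        lower_redundancy ip {1..N} W = 1 \<and> upper_redundancy ip {1..N} W = 1 \<and>
        (\<forall>i\<in>{1..N}. snd (W i) = 1))
     \<and>
     (\<forall>(M::nat) (E :: (nat, 'a) weighted_family).
        orthonormal_fusion_basis scaleK ip {1..M} E \<longrightarrow>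
          lower_redundancy ip ({1..N} <+> {1..M}) (family_union W E)
            = lower_redundancy ip {1..N} W + 1 \<and>
          upper_redundancy ip ({1..N} <+> {1..M}) (family_union W E)
            = upper_redundancy ip {1..N} W + 1)
     \<and>
     (\<forall>(M::nat) (V :: (nat, 'a) weighted_family).
        fusion_frame scaleK ip {1..M} V \<longrightarrow>
          lower_redundancy ip ({1..N} <+> {1..M}) (family_union W V)
            \<ge> lower_redundancy ip {1..N} W + lower_redundancy ip {1..M} V \<and>
          upper_redundancy ip ({1..N} <+> {1..M}) (family_union W V)
            \<le> upper_redundancy ip {1..N} W + upper_redundancy ip {1..M} V \<and>
          (uniform_redundancy ip {1..N} W \<and> uniform_redundancy ip {1..M} V \<longrightarrow>
             lower_redundancy ip ({1..N} <+> {1..M}) (family_union W V)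
               = upper_redundancy ip {1..N} W + upper_redundancy ip {1..M} V \<and>
             upper_redundancy ip {1..N} W + upper_redundancy ip {1..M} V
               = upper_redundancy ip ({1..N} <+> {1..M}) (family_union W V)))
     \<and>
     (\<forall>U. unitary_operator scaleK ip U \<longrightarrow>
        lower_redundancy ip {1..N} (family_image U W) = lower_redundancy ip {1..N} W \<and>
        upper_redundancy ip {1..N} (family_image U W) = upper_redundancy ip {1..N} W)
     \<and>
     (\<forall>\<pi>. \<pi> permutes {1..N} \<longrightarrow>
        lower_redundancy ip {1..N} (\<lambda>i. W (\<pi> i)) = lower_redundancy ip {1..N} W \<and>
        upper_redundancy ip {1..N} (\<lambda>i. W (\<pi> i)) = upper_redundancy ip {1..N} W)"
proof -
  interpret hilbert_space scaleK ip
    by fact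
  have ne: "sphere (0::'a) 1 \<noteq> {}"
    using assms(2,3) by (intro sphere_nonempty) simp
  have sub: "closed_subspace scaleK (fst (W i))" if "i \<in> {1..N}" for i
    using fusion_frameD(1)[OF assms(4) that] .
  show ?thesis
  proof (intro conjI allI impI)
    fix A
    show "tight_fusion_frame scaleK ip A {1..N} (normalized W) \<longleftrightarrow>
        lower_redundancy ip {1..N} W = A \<and> upper_redundancy ip {1..N} W = A"
      by (rule tight_normalized_iff[OF assms(4) _ ne]) simp
  next
    show "orthonormal_fusion_basis scaleK ip {1..N} W \<longleftrightarrow>
        lower_redundancy ip {1..N} W = 1 \<and> upper_redundancy ip {1..N} W = 1 \<and>
        (\<forall>i\<in>{1..N}. snd (W i) = 1)"
      by (rule orthonormal_fusion_basis_iff[OF assms(4) _ ne]) simp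
  next
    fix M :: nat and E :: "(nat, 'a) weighted_family"
    assume E: "orthonormal_fusion_basis scaleK ip {1..M} E"
    then have subE: "closed_subspace scaleK (fst (E i))" if "i \<in> {1..M}" for i
      using that by (simp add: orthonormal_fusion_basis_def)
    have 1: "lower_redundancy ip {1..M} E = 1" "upper_redundancy ip {1..M} E = 1"
      using redundancy_bounds_eq_iff[of "{1..M}" E 1, OF subE ne]
        redundancy_orthonormal_fusion_basis[OF E] by auto
    show "lower_redundancy ip ({1..N} <+> {1..M}) (family_union W E)
            = lower_redundancy ip {1..N} W + 1"
      "upper_redundancy ip ({1..N} <+> {1..M}) (family_union W E)
            = upper_redundancy ip {1..N} W + 1"
      by (rule redundancy_union_uniform[OF sub _ subE _ ne 1]; simp)+
  next
    fix M :: nat and V :: "(nat, 'a) weighted_family"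
    assume "fusion_frame scaleK ip {1..M} V"
    note subV = fusion_frameD(1)[OF this]
    show "lower_redundancy ip ({1..N} <+> {1..M}) (family_union W V)
        \<ge> lower_redundancy ip {1..N} W + lower_redundancy ip {1..M} V"
      by (rule lower_redundancy_union_ge[OF sub _ subV _ ne]; simp)
    show "upper_redundancy ip ({1..N} <+> {1..M}) (family_union W V)
        \<le> upper_redundancy ip {1..N} W + upper_redundancy ip {1..M} V"
      by (rule upper_redundancy_union_le[OF sub _ subV _ ne]; simp)
    assume u: "uniform_redundancy ip {1..N} W \<and> uniform_redundancy ip {1..M} V"
    then have uV: "lower_redundancy ip {1..M} V = upper_redundancy ip {1..M} V"
      and uW: "upper_redundancy ip {1..N} W = lower_redundancy ip {1..N} W"
      by (simp_all add: uniform_redundancy_def)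
    show "lower_redundancy ip ({1..N} <+> {1..M}) (family_union W V)
        = upper_redundancy ip {1..N} W + upper_redundancy ip {1..M} V"
      \<comment> \<open>Uniformity of \<open>V\<close> supplies its upper redundancy as the
        constant, and \<open>uW\<close> replaces the upper redundancy of \<open>W\<close> by the
        lower one to match the rule.\<close>
      unfolding uW by (rule redundancy_union_uniform(1)[OF sub _ subV _ ne uV refl]; simp)
    show "upper_redundancy ip {1..N} W + upper_redundancy ip {1..M} V
        = upper_redundancy ip ({1..N} <+> {1..M}) (family_union W V)"
      by (rule redundancy_union_uniform(2)[OF sub _ subV _ ne uV refl, symmetric]; simp)
  next
    fix U
    assume U: "unitary_operator scaleK ip U"
    show "lower_redundancy ip {1..N} (family_image U W) = lower_redundancy ip {1..N} W"
      "upper_redundancy ip {1..N} (family_image U W) = upper_redundancy ip {1..N} W"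
      by (rule redundancy_bounds_unitary[OF U sub]; simp)+
  next
    fix \<pi>
    assume "\<pi> permutes {1..N}"
    then show "lower_redundancy ip {1..N} (\<lambda>i. W (\<pi> i)) = lower_redundancy ip {1..N} W"
      "upper_redundancy ip {1..N} (\<lambda>i. W (\<pi> i)) = upper_redundancy ip {1..N} W"
      by (simp_all add: lower_redundancy_def upper_redundancy_def redundancy_permutes)
  qed
qed

end
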